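(* Let $A=(a_{ij})$ and $B=(b_{ij})$ be real $I\times J$ matrices with non-negative entries, $I\le J$, such that $\sum_{i=1}^{I}a_{ij}=1$ for every $j=1,\dots,J$ and $\sum_{j=1}^{J}b_{ij}=1$ for every $i=1,\dots,I$. Consider the linear programming problem: maximize $$f(p)=\sum_{i=1}^{I}\sum_{j=1}^{J}p_{ij}$$ over real vectors $p=(p_{11},p_{12},\dots,p_{IJ})^{T}$ subject to $$a_{ij}\sum_{s=1}^{I}p_{sj}-b_{ij}\sum_{k=1}^{J}p_{ik}=0\quad\text{and}\quad 0\le p_{ij}\le 1\qquad\text{for every }(i,j).$$ Then $\max f(p)>0$ if and only if $A$ and $B$ are compatible.
   Context: The matrices $A$ and $B$ are called compatible if there exist stochastic (probability) vectors $\tau=(\tau_1,\dots,\tau_J)$ and $\eta=(\eta_1,\dots,\eta_I)$ (non-negative entries summing to $1$) such that $a_{ij}\tau_j=b_{ij}\eta_i$ for every $(i,j)$; then $p_{ij}=a_{ij}\tau_j=b_{ij}\eta_i$ is a joint probability matrix. *)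

theory Defs
  imports "HOL-Analysis.Finite_Cartesian_Product"
begin

text \<open>
  An \<open>I \<times> J\<close> matrix is a vector of rows, so \<open>A $ i $ j\<close> is the entry \<open>a\<^sub>i\<^sub>j\<close>, with
  \<open>I = CARD('i)\<close> and \<open>J = CARD('j)\<close>.
\<close>

definition stochastic_vector :: "real ^ 'n \<Rightarrow> bool" where
  "stochastic_vector v \<longleftrightarrow> (\<forall>k. 0 \<le> v $ k) \<and> (\<Sum>k\<in>UNIV. v $ k) = 1"

definition compatible :: "real ^ 'j ^ 'i \<Rightarrow> real ^ 'j ^ 'i \<Rightarrow> bool" where
  "compatible A B \<longleftrightarrow>
     (\<exists>(\<tau> :: real ^ 'j) (\<eta> :: real ^ 'i).
        stochastic_vector \<tau> \<and> stochastic_vector \<eta> \<and>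
        (\<forall>i j. A $ i $ j * \<tau> $ j = B $ i $ j * \<eta> $ i))"

definition lp_feasible ::
  "real ^ 'j ^ 'i \<Rightarrow> real ^ 'j ^ 'i \<Rightarrow> (real ^ ('i::finite \<times> 'j::finite)) set" where
  "lp_feasible A B =
     {p. \<forall>i j. A $ i $ j * (\<Sum>s\<in>UNIV. p $ (s, j)) - B $ i $ j * (\<Sum>k\<in>UNIV. p $ (i, k)) = 0 \<and>
               0 \<le> p $ (i, j) \<and> p $ (i, j) \<le> 1}"

definition lp_objective :: "real ^ ('i::finite \<times> 'j::finite) \<Rightarrow> real" where
  "lp_objective p = (\<Sum>i\<in>UNIV. \<Sum>j\<in>UNIV. p $ (i, j))"

text \<open>
  The value is unspecified if the maximum is not attained; attainment therefore has to be
  asserted separately.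
\<close>

definition lp_max :: "real ^ 'j ^ 'i \<Rightarrow> real ^ 'j ^ 'i \<Rightarrow> real" where
  "lp_max A B = (GREATEST m. m \<in> lp_objective ` lp_feasible A B)"

end

theory Submission
  imports Defs "HOL-Analysis.Cartesian_Euclidean_Space"
begin

text \<open>
  The column sums and the row sums of a feasible point with positive objective value, divided by
  that value, are stochastic vectors witnessing compatibility. Conversely a compatible pair yields
  the feasible point \<open>a\<^sub>i\<^sub>j \<tau>\<^sub>j = b\<^sub>i\<^sub>j \<eta>\<^sub>i\<close>, whose column sums are \<open>\<tau>\<close>, whose row sums are
  \<open>\<eta>\<close>, and whose objective value is therefore 1. The maximum is attained by compactness.
\<close>

text \<open>The constraints are equations and weak inequalities between continuous functions of
  \<open>p\<close>, so they cut out a closed set; the bounds on the entries keep it inside the unit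
  cube.\<close>

lemma compact_lp_feasible:
  fixes A B :: "real ^ 'j::finite ^ 'i::finite"
  shows "compact (lp_feasible A B)"
proof -
  have "closed (lp_feasible A B)"
    unfolding lp_feasible_def
    by (intro closed_Collect_all closed_Collect_conj closed_Collect_eq closed_Collect_le
        continuous_intros)
  moreover have "lp_feasible A B \<subseteq> cbox 0 1"
    by (auto simp: lp_feasible_def mem_box_cart)
  ultimately show ?thesis
    by (metis bounded_cbox bounded_subset compact_eq_bounded_closed)
qed

lemma zero_in_lp_feasible: "0 \<in> lp_feasible A B"
  by (simp add: lp_feasible_def)

lemma lp_objective_attains_max:
  fixes A B :: "real ^ 'j::finite ^ 'i::finite"
  shows "\<exists>p\<in>lp_feasible A B. \<forall>q\<in>lp_feasible A B. lp_objective q \<le> lp_objective p"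
proof (rule continuous_attains_sup)
  show "compact (lp_feasible A B)"
    by (rule compact_lp_feasible)
  show "lp_feasible A B \<noteq> {}"
    using zero_in_lp_feasible by blast
  show "continuous_on (lp_feasible A B) lp_objective"
    unfolding lp_objective_def by (intro continuous_intros)
qed

text \<open>Since \<open>lp_max\<close> is defined by \<open>GREATEST\<close>, its value is known
  only once a maximiser is exhibited.\<close>

lemma lp_max_eqI:
  assumes "p \<in> lp_feasible A B" and "\<And>q. q \<in> lp_feasible A B \<Longrightarrow> lp_objective q \<le> lp_objective p"
  shows "lp_max A B = lp_objective p"
  unfolding lp_max_def using assms by (intro Greatest_equality) auto

lemma compatible_if_lp_objective_pos:
  fixes A B :: "real ^ 'j::finite ^ 'i::finite"
  assumes p: "p \<in> lp_feasible A B" and pos: "lp_objective p > 0"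
  shows "compatible A B"
proof -
  define \<tau> :: "real ^ 'j" where "\<tau> = (\<chi> j. (\<Sum>s\<in>UNIV. p $ (s, j)) / lp_objective p)"
  define \<eta> :: "real ^ 'i" where "\<eta> = (\<chi> i. (\<Sum>k\<in>UNIV. p $ (i, k)) / lp_objective p)"
  \<comment> \<open>The order of summation is exchanged so that the column sums add up to the
    divisor in \<open>\<tau>\<close>.\<close>
  have "(\<Sum>j\<in>UNIV. \<Sum>i\<in>UNIV. p $ (i, j)) = lp_objective p"
    unfolding lp_objective_def by (rule sum.swap)
  then have "stochastic_vector \<tau>"
    using p pos unfolding stochastic_vector_def \<tau>_def lp_feasible_def
    by (auto simp flip: sum_divide_distrib intro!: divide_nonneg_pos sum_nonneg)
  moreover have "(\<Sum>i\<in>UNIV. \<Sum>j\<in>UNIV. p $ (i, j)) = lp_objective p"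
    by (simp add: lp_objective_def)
  then have "stochastic_vector \<eta>"
    using p pos unfolding stochastic_vector_def \<eta>_def lp_feasible_def
    by (auto simp flip: sum_divide_distrib intro!: divide_nonneg_pos sum_nonneg)
  \<comment> \<open>The equality constraint is homogeneous in \<open>p\<close>, so it survives
    division by the objective value.\<close>
  moreover have "A $ i $ j * \<tau> $ j = B $ i $ j * \<eta> $ i" for i j
    using p by (simp add: \<tau>_def \<eta>_def lp_feasible_def)
  ultimately show ?thesis
    unfolding compatible_def by blast
qed

lemma compatible_imp_lp_objective_eq_1:
  fixes A B :: "real ^ 'j::finite ^ 'i::finite"
  assumes nonneg: "\<And>i j. 0 \<le> A $ i $ j"
    and col: "\<And>j. (\<Sum>i\<in>UNIV. A $ i $ j) = 1"
    and row: "\<And>i. (\<Sum>j\<in>UNIV. B $ i $ j) = 1"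
    and "compatible A B"
  obtains p where "p \<in> lp_feasible A B" and "lp_objective p = 1"
proof -
  obtain \<tau> \<eta> where \<tau>: "stochastic_vector \<tau>" and \<eta>: "stochastic_vector \<eta>"
    and eq: "\<And>i j. A $ i $ j * \<tau> $ j = B $ i $ j * \<eta> $ i"
    using \<open>compatible A B\<close> unfolding compatible_def by blast
  define p :: "real ^ ('i \<times> 'j)" where "p = (\<chi> x. A $ fst x $ snd x * \<tau> $ snd x)"
  have p_nth: "p $ (i, j) = A $ i $ j * \<tau> $ j" for i j
    by (simp add: p_def)
  have col_sum: "(\<Sum>s\<in>UNIV. p $ (s, j)) = \<tau> $ j" for j
    by (simp add: p_nth col flip: sum_distrib_right)
  \<comment> \<open>By \<open>eq\<close> the entries also equal
    \<open>B $ i $ k * \<eta> $ i\<close>, and the rows of \<open>B\<close> sum to 1.\<close>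
  have row_sum: "(\<Sum>k\<in>UNIV. p $ (i, k)) = \<eta> $ i" for i
    by (simp add: p_nth eq row flip: sum_distrib_right)
  have p_nonneg: "0 \<le> p $ (i, j)" for i j
    using nonneg \<tau> by (simp add: p_nth stochastic_vector_def)
  \<comment> \<open>An entry is at most its row sum, which is an entry of the stochastic vector
    \<open>\<eta>\<close>.\<close>
  have "p $ (i, j) \<le> 1" for i j
  proof -
    have "p $ (i, j) \<le> (\<Sum>k\<in>UNIV. p $ (i, k))"
      by (intro member_le_sum) (auto simp: p_nonneg)
    also have "\<dots> = \<eta> $ i"
      by (rule row_sum)
    also have "\<dots> \<le> (\<Sum>i\<in>UNIV. \<eta> $ i)"
      using \<eta> by (intro member_le_sum) (auto simp: stochastic_vector_def)
    also have "\<dots> = 1"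
      using \<eta> by (simp add: stochastic_vector_def)
    finally show ?thesis .
  qed
  \<comment> \<open>With the row and column sums inserted, the equality constraint becomes
    \<open>eq\<close>.\<close>
  then have "p \<in> lp_feasible A B"
    by (simp add: lp_feasible_def col_sum row_sum p_nonneg eq)
  moreover have "lp_objective p = 1"
    using \<eta> by (simp add: lp_objective_def row_sum stochastic_vector_def)
  ultimately show thesis
    by (rule that)
qed

theorem theorem2:
  fixes A B :: "real ^ 'j ^ 'i"
  assumes "CARD('i) \<le> CARD('j)"
    and "\<And>i j. 0 \<le> A $ i $ j"
    and "\<And>i j. 0 \<le> B $ i $ j"
    and "\<And>j. (\<Sum>i\<in>UNIV. A $ i $ j) = 1"
    and "\<And>i. (\<Sum>j\<in>UNIV. B $ i $ j) = 1"
  shows "(\<exists>p\<in>lp_feasible A B. \<forall>q\<in>lp_feasible A B. lp_objective q \<le> lp_objective p) \<and>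
         (lp_max A B > 0 \<longleftrightarrow> compatible A B)"
proof
  show "\<exists>p\<in>lp_feasible A B. \<forall>q\<in>lp_feasible A B. lp_objective q \<le> lp_objective p"
    by (rule lp_objective_attains_max)
  then obtain p where p: "p \<in> lp_feasible A B"
    and max: "\<And>q. q \<in> lp_feasible A B \<Longrightarrow> lp_objective q \<le> lp_objective p"
    by blast
  have "lp_max A B = lp_objective p"
    using p max by (rule lp_max_eqI)
  moreover have "compatible A B" if "lp_objective p > 0"
    using p that by (rule compatible_if_lp_objective_pos)
  moreover have "lp_objective p > 0" if "compatible A B"
  proof -
    obtain q where "q \<in> lp_feasible A B" "lp_objective q = 1"
      using assms(2,4,5) \<open>compatible A B\<close> by (rule compatible_imp_lp_objective_eq_1)
    \<comment> \<open>The maximum is at least the value 1 attained at \<open>q\<close>.\<close>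
    then show ?thesis
      using max by force
  qed
  ultimately show "lp_max A B > 0 \<longleftrightarrow> compatible A B"
    by auto
qed

end
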